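(* Let $n\ge 5$ be an integer and $\alpha,\beta,p,\lambda,\mu\in\mathbb{R}$ with $-n<\alpha\le-2$, $p>1$, $\frac{n+\alpha}{2}+\frac{n+\beta}{p+1}=n-2$, $\mu\ge0$ and $\lambda>(n-2)(2+\alpha)+2\sqrt{\mu}$. Set $$K_2=\frac{(n-2)^2+(\alpha+2)^2}{2}-\lambda,\qquad K_0=\frac{(n-4-\alpha)^2(n+\alpha)^2}{16}-\lambda\left(\frac{n-4-\alpha}{2}\right)^2+\mu,$$ and assume $K_0>0$, $K_2>0$. Let $v\in H^2(\mathbb{R})$ be the solution of $$v^{(4)}-K_2v''+K_0v=v^p\quad\text{in }\mathbb{R}$$ that is positive, even and strictly decreasing on $(0,\infty)$, and let $u(|x|)=|x|^{-\frac{n-4-\alpha}{2}}v(t)$ with $t=-\ln|x|$. Then $u(0)=+\infty$, i.e. $u(|x|)\to+\infty$ as $x\to0$.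
   Context: Known fact identifying $v$: if $q>1$, $A,B>0$ and $A^2-4B\ge0$, then $w^{(4)}-Aw''+Bw=|w|^{q-1}w$ on $\mathbb{R}$ has a nontrivial solution $w\in H^2(\mathbb{R})$, unique up to translations, the inversion $s\mapsto -s$ and change of sign, and it can be taken even, positive and strictly decreasing on $\mathbb{R}_+$. Under the assumptions on $\lambda,\mu$ here, $K_2^2-4K_0=(\lambda-(n-2)(\alpha+2))^2-4\mu>0$, so this applies with $A=K_2$, $B=K_0$, $q=p$. *)

theory Defs
  imports "HOL-Analysis.Analysis"
begin

definition smooth :: "(real \<Rightarrow> real) \<Rightarrow> bool" where
  "smooth f \<longleftrightarrow> (\<forall>k. (deriv ^^ k) f differentiable_on UNIV)"

definition test_function :: "(real \<Rightarrow> real) \<Rightarrow> bool" where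
  "test_function \<phi> \<longleftrightarrow> smooth \<phi> \<and> compact (closure {t. \<phi> t \<noteq> 0})"

definition locally_integrable :: "(real \<Rightarrow> real) \<Rightarrow> bool" where
  "locally_integrable f \<longleftrightarrow> (\<forall>a b. set_integrable lebesgue {a..b} f)"

definition square_integrable :: "(real \<Rightarrow> real) \<Rightarrow> bool" where
  "square_integrable f \<longleftrightarrow>
     f \<in> borel_measurable lebesgue \<and> integrable lebesgue (\<lambda>t. (f t)\<^sup>2)"

text \<open>The function \<open>g\<close> is a \<open>k\<close>-th weak derivative of \<open>f\<close> on the real line. It is determined
  by \<open>f\<close> only up to null sets.\<close>

definition weak_derivative :: "nat \<Rightarrow> (real \<Rightarrow> real) \<Rightarrow> (real \<Rightarrow> real) \<Rightarrow> bool" where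
  "weak_derivative k f g \<longleftrightarrow>
     locally_integrable f \<and> locally_integrable g \<and>
     (\<forall>\<phi>. test_function \<phi> \<longrightarrow>
        (\<integral>t. f t * (deriv ^^ k) \<phi> t \<partial>lebesgue) = (-1) ^ k * (\<integral>t. g t * \<phi> t \<partial>lebesgue))"

text \<open>The Sobolev space \<open>H\<^sup>2(\<real>)\<close>, as a set of functions rather than of classes modulo equality
  almost everywhere.\<close>

definition sobolev_H2 :: "(real \<Rightarrow> real) set" where
  "sobolev_H2 = {f. square_integrable f \<and>
     (\<exists>f1 f2. weak_derivative 1 f f1 \<and> square_integrable f1 \<and>
              weak_derivative 2 f f2 \<and> square_integrable f2)}"

text \<open>Nonnegative weak solutions of \<open>v'''' - A v'' + B v = v\<^sup>q\<close> on the real line. If \<open>v\<close> lies in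
  \<open>H\<^sup>2(\<real>)\<close> then \<open>v\<^sup>q\<close> is locally bounded, so every distributional solution has a locally
  integrable weak fourth derivative, and asking for one below is no restriction. A classical
  solution is a weak solution with its ordinary derivatives in place of \<open>v2\<close> and \<open>v4\<close>.\<close>

definition weak_solution :: "real \<Rightarrow> real \<Rightarrow> real \<Rightarrow> (real \<Rightarrow> real) \<Rightarrow> bool" where
  "weak_solution A B q v \<longleftrightarrow>
     (\<forall>t. 0 \<le> v t) \<and>
     (\<exists>v2 v4. weak_derivative 2 v v2 \<and> weak_derivative 4 v v4 \<and>
        (AE t in lebesgue. v4 t - A * v2 t + B * v t = v t powr q))"

end

theory Submission
  imports Defs
begin

text \<open>Put \<open>g = (n - 4 - \<alpha>) / 2\<close> and \<open>t = - ln \<bar>x\<bar>\<close>, so that \<open>u = exp (g t) v t\<close>. The claim is that \<open>v\<close>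
  decays more slowly than \<open>exp (- g t)\<close>.

  The linear part of the equation factors as \<open>(D\<^sup>2 - r\<^sup>2) (D\<^sup>2 - s\<^sup>2)\<close> with \<open>0 < r < s\<close>, and the
  nonlinear term is nonnegative. A positive solution of the resulting differential inequality
  that is bounded with its derivatives cannot decay faster than the slow exponential:
  \<open>v t \<ge> c exp (- r t)\<close> for \<open>t > 0\<close>, with \<open>c > 0\<close>. This comes
  from two applications of an elementary comparison principle
  (\<open>bounded_supersolution_nonneg\<close>, \<open>first_order_factor_nonneg\<close>), combined in
  \<open>fourth_order_lower_bound\<close>. On the other hand \<open>r < g\<close>, because the characteristic polynomial takes
  the value \<open>\<mu> \<ge> 0\<close> at \<open>g\<^sup>2\<close>, which lies to the right of the midpoint of its roots
  (\<open>characteristic_roots\<close>). Together, \<open>u \<ge> c exp ((g - r) t)\<close>, which tends to infinity.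

  The equation holds only in the weak sense, but the inequality
  is linear and therefore survives convolution with a nonnegative test function. The convolution is smooth,
  its derivatives are bounded because \<open>v\<close> is square integrable, and its lower bound passes to \<open>v\<close>
  because \<open>v\<close> is decreasing (\<open>weak_solution_exponential_lower_bound\<close>). The test function
  is constructed from \<open>exp (- 1 / (1 - x\<^sup>2))\<close>.\<close>

section \<open>A bump function\<close>

lemma continuous_on_interval_bounded:
  fixes g :: "real \<Rightarrow> real"
  assumes "continuous_on {a..b} g"
  obtains C where "\<And>x. x \<in> {a..b} \<Longrightarrow> \<bar>g x\<bar> \<le> C"
proof -
  have "compact (g ` {a..b})" using assms by (intro compact_continuous_image) auto
  then show thesis
    using that unfolding compact_eq_bounded_closed bounded_iff by fastforce
qed

text \<open>Allowing a polynomial factor and a power of \<open>1 - x\<^sup>2\<close> makes the family closed under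
  differentiation, so that the smoothness of the standard bump \<open>bump 1 0\<close> reduces to the
  differentiability of each member.\<close>

definition bump :: "real poly \<Rightarrow> nat \<Rightarrow> real \<Rightarrow> real" where
  "bump p k x = (if \<bar>x\<bar> < 1 then poly p x / (1 - x\<^sup>2) ^ k * exp (- 1 / (1 - x\<^sup>2)) else 0)"

lemma bump_eq_0: "1 \<le> \<bar>x\<bar> \<Longrightarrow> bump p k x = 0"
  by (simp add: bump_def)

text \<open>One term of the exponential series, \<open>y ^ m / fact m \<le> exp y\<close>, at \<open>y = 1 / w\<close> and \<open>m = k + 2\<close>.
  The two spare powers of \<open>w\<close> give the flatness at the endpoints.\<close>

lemma exp_minus_inverse_le:
  fixes w :: real
  assumes "0 < w"
  shows "exp (- 1 / w) / w ^ k \<le> fact (k + 2) * w\<^sup>2"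
proof -
  have "(\<Sum>n\<in>{k + 2}. (1 / w) ^ n /\<^sub>R fact n) \<le> (\<Sum>n. (1 / w) ^ n /\<^sub>R fact n)"
    using assms by (intro sum_le_suminf summable_exp_generic) auto
  then have "(1 / w) ^ (k + 2) / fact (k + 2) \<le> exp (1 / w)"
    by (simp add: exp_def divide_inverse mult.commute)
  then have "1 \<le> fact (k + 2) * w ^ (k + 2) * exp (1 / w)"
    using assms by (simp add: field_simps power_one_over del: fact_Suc)
  then have "exp (- 1 / w) \<le> fact (k + 2) * w ^ (k + 2)"
    using assms by (simp add: exp_minus field_simps del: fact_Suc)
  then show ?thesis
    using assms by (simp add: field_simps power_add power2_eq_square del: fact_Suc)
qed

text \<open>At points outside the open interval \<open>(-1, 1)\<close>, the endpoints included, the function vanishes to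
  second order; its derivative there is therefore \<open>0\<close>.\<close>

lemma bump_quadratic_bound:
  "\<exists>C. \<forall>x y. 1 \<le> \<bar>y\<bar> \<longrightarrow> \<bar>bump p k x\<bar> \<le> C * (x - y)\<^sup>2"
proof -
  have "continuous_on {-1..1} (poly p)" by (intro continuous_intros)
  then obtain B where B: "\<And>x. x \<in> {-1..1} \<Longrightarrow> \<bar>poly p x\<bar> \<le> B"
    using continuous_on_interval_bounded by blast
  have B0: "0 \<le> B" using B[of 0] by simp
  have "\<bar>bump p k x\<bar> \<le> (B * fact (k + 2) * 4) * (x - y)\<^sup>2" if y: "1 \<le> \<bar>y\<bar>" for x y
  proof (cases "\<bar>x\<bar> < 1")
    case False
    then show ?thesis using B0 by (simp add: bump_def)
  next
    case True
    define w where "w = 1 - x\<^sup>2"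
    have wpos: "0 < w" using True unfolding w_def by (simp add: abs_square_less_1)
    have "w = (1 - \<bar>x\<bar>) * (1 + \<bar>x\<bar>)"
      unfolding w_def by (simp add: algebra_simps power2_eq_square)
    also have "\<dots> \<le> (1 - \<bar>x\<bar>) * 2" using True by (intro mult_left_mono) auto
    also have "\<dots> \<le> \<bar>x - y\<bar> * 2" using y by (intro mult_right_mono) auto
    finally have "w\<^sup>2 \<le> (\<bar>x - y\<bar> * 2)\<^sup>2" using wpos by (intro power_mono) auto
    then have w2: "w\<^sup>2 \<le> 4 * (x - y)\<^sup>2" by (simp add: power_mult_distrib)
    have "\<bar>bump p k x\<bar> = \<bar>poly p x\<bar> * (exp (- 1 / w) / w ^ k)"
      using True wpos by (simp add: bump_def w_def[symmetric] abs_mult)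
    also have "\<dots> \<le> B * (fact (k + 2) * w\<^sup>2)"
      using True B0 wpos
      by (intro mult_mono B exp_minus_inverse_le[OF wpos]) auto
    also have "\<dots> \<le> B * (fact (k + 2) * (4 * (x - y)\<^sup>2))"
      using w2 B0 by (intro mult_left_mono) auto
    finally show ?thesis by (simp only: mult_ac)
  qed
  then show ?thesis by blast
qed

text \<open>For \<open>q = 1 - x\<^sup>2\<close>, the numerator over \<open>q ^ (k + 2)\<close> in the derivative of
  \<open>p / q ^ k * exp (- 1 / q)\<close>.\<close>

definition bump_deriv_poly :: "real poly \<Rightarrow> nat \<Rightarrow> real poly" where
  "bump_deriv_poly p k =
     (let q = [:1, 0, -1:] in pderiv p * q\<^sup>2 - of_nat k * p * pderiv q * q + p * pderiv q)"

lemma has_real_derivative_bump: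
  "(bump p k has_real_derivative bump (bump_deriv_poly p k) (k + 2) x) (at x)"
proof (cases "\<bar>x\<bar> < 1")
  case True
  define w where "w = 1 - x\<^sup>2"
  have wpos: "0 < w" using True unfolding w_def by (simp add: abs_square_less_1)
  have dw: "((\<lambda>x. 1 - x\<^sup>2) has_real_derivative - 2 * x) (at x)"
    by (auto intro!: derivative_eq_intros)
  have dexp: "((\<lambda>x. exp (- 1 / (1 - x\<^sup>2))) has_real_derivative
      exp (- 1 / w) * ((- 2 * x) / (w * w))) (at x)"
    using wpos by (auto intro!: derivative_eq_intros dw simp: w_def)
  have dpow: "((\<lambda>x. (1 - x\<^sup>2) ^ k) has_real_derivative of_nat k * w ^ (k - 1) * (- 2 * x)) (at x)"
    by (auto intro!: derivative_eq_intros dw simp: w_def)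
  have "((\<lambda>x. poly p x / (1 - x\<^sup>2) ^ k * exp (- 1 / (1 - x\<^sup>2))) has_real_derivative
      (poly (pderiv p) x * w ^ k - poly p x * (of_nat k * w ^ (k - 1) * (- 2 * x)))
        / (w ^ k * w ^ k) * exp (- 1 / w)
      + poly p x / w ^ k * (exp (- 1 / w) * ((- 2 * x) / (w * w)))) (at x)"
    using DERIV_mult[OF DERIV_divide[OF poly_DERIV dpow] dexp] wpos
    by (simp add: w_def[symmetric] algebra_simps)
  also have "(poly (pderiv p) x * w ^ k - poly p x * (of_nat k * w ^ (k - 1) * (- 2 * x)))
        / (w ^ k * w ^ k) * exp (- 1 / w)
      + poly p x / w ^ k * (exp (- 1 / w) * ((- 2 * x) / (w * w)))
    = bump (bump_deriv_poly p k) (k + 2) x"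
  proof -
    have q: "poly [:1, 0, -1:] x = w" "poly (pderiv [:1, 0, -1:]) x = - 2 * x"
      by (auto simp: w_def pderiv_pCons power2_eq_square)
    have e: "poly (bump_deriv_poly p k) x
        = poly (pderiv p) x * w\<^sup>2 - of_nat k * poly p x * (- 2 * x) * w + poly p x * (- 2 * x)"
      unfolding bump_deriv_poly_def Let_def poly_add poly_diff poly_mult poly_power q
      by simp
    have k: "of_nat k * w ^ (k - 1) = of_nat k * w ^ k / w"
      using wpos by (cases k) auto
    show ?thesis
      unfolding bump_def w_def[symmetric] e k using True wpos
      by (simp add: field_simps power2_eq_square)
  qed
  finally have d: "((\<lambda>x. poly p x / (1 - x\<^sup>2) ^ k * exp (- 1 / (1 - x\<^sup>2))) has_real_derivative
      bump (bump_deriv_poly p k) (k + 2) x) (at x)" .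
  show ?thesis
  proof (rule has_field_derivative_transform_within_open[OF d, of "{-1<..<1}"])
    show "x \<in> {-1<..<1}" using True by auto
  qed (auto simp: bump_def)
next
  case False
  obtain C where C: "\<And>z y. 1 \<le> \<bar>y\<bar> \<Longrightarrow> \<bar>bump p k z\<bar> \<le> C * (z - y)\<^sup>2"
    using bump_quadratic_bound by blast
  have "((\<lambda>h. (bump p k (x + h) - bump p k x) / h) \<longlongrightarrow> 0) (at 0)"
  proof (rule Lim_null_comparison)
    show "((\<lambda>h. C * \<bar>h\<bar>) \<longlongrightarrow> 0) (at 0)"
      by (auto intro!: tendsto_eq_intros)
    show "\<forall>\<^sub>F h in at 0. norm ((bump p k (x + h) - bump p k x) / h) \<le> C * \<bar>h\<bar>"
    proof (rule always_eventually)
      show "\<forall>h. norm ((bump p k (x + h) - bump p k x) / h) \<le> C * \<bar>h\<bar>"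
      proof
        fix h :: real
        show "norm ((bump p k (x + h) - bump p k x) / h) \<le> C * \<bar>h\<bar>"
          using C[of x "x + h"] False
          by (cases "h = 0") (auto simp: bump_eq_0 divide_le_eq power2_eq_square mult.assoc abs_mult_self_eq)
      qed
    qed
  qed
  then show ?thesis using False by (simp add: DERIV_def bump_eq_0)
qed

lemma deriv_bump: "deriv (bump p k) = bump (bump_deriv_poly p k) (k + 2)"
  using has_real_derivative_bump DERIV_imp_deriv by blast

lemma higher_deriv_bump: "\<exists>p' k'. (deriv ^^ j) (bump p k) = bump p' k'"
proof (induction j)
  case (Suc j)
  then show ?case by (metis deriv_bump funpow.simps(2) comp_apply)
qed auto

lemma test_function_bump: "test_function (bump 1 0)"
proof -
  have "(deriv ^^ k) (bump 1 0) differentiable_on UNIV" for k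
  proof -
    obtain p' k' where "(deriv ^^ k) (bump 1 0) = bump p' k'" using higher_deriv_bump by blast
    then show ?thesis
      using has_real_derivative_bump
      by (auto simp: differentiable_on_def real_differentiable_def intro: differentiable_at_withinI)
  qed
  moreover have "bounded {t. bump 1 0 t \<noteq> 0}"
    by (rule bounded_subset[of "{-1..1}"]) (auto simp: bump_def split: if_splits)
  then have "compact (closure {t. bump 1 0 t \<noteq> 0})" by (simp add: compact_closure)
  ultimately show ?thesis by (simp add: test_function_def smooth_def)
qed

lemma higher_deriv_bump_props:
  fixes k :: nat
  defines "g \<equiv> (deriv ^^ k) (bump 1 0)"
  shows "(g has_real_derivative (deriv ^^ Suc k) (bump 1 0) x) (at x)"
    and "continuous_on UNIV g" and "1 \<le> \<bar>x\<bar> \<Longrightarrow> g x = 0"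
proof -
  obtain p' k' where g: "g = bump p' k'" unfolding g_def using higher_deriv_bump by blast
  show "(g has_real_derivative (deriv ^^ Suc k) (bump 1 0) x) (at x)"
    using has_real_derivative_bump[of p' k' x] g by (simp add: g_def deriv_bump)
  show "continuous_on UNIV g"
    unfolding g using has_real_derivative_bump
    by (auto intro!: continuous_at_imp_continuous_on DERIV_isCont)
  show "1 \<le> \<bar>x\<bar> \<Longrightarrow> g x = 0" by (simp add: g bump_eq_0)
qed

section \<open>Mollification\<close>

lemma has_real_derivative_shift:
  fixes f :: "real \<Rightarrow> real"
  shows "((\<lambda>s. f (s - t)) has_real_derivative D) (at s) \<longleftrightarrow> (f has_real_derivative D) (at (s - t))"
  using DERIV_shift[of f D s "- t"] by simp

lemma higher_deriv_shift:
  fixes f :: "real \<Rightarrow> real"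
  shows "(deriv ^^ k) (\<lambda>s. f (s - t)) = (\<lambda>s. (deriv ^^ k) f (s - t))"
proof (induction k)
  case (Suc k)
  have "deriv (\<lambda>s. g (s - t)) = (\<lambda>s. deriv g (s - t))" for g :: "real \<Rightarrow> real"
    unfolding deriv_def has_real_derivative_shift ..
  with Suc show ?case by simp
qed simp

lemma test_function_shift:
  assumes "test_function \<phi>"
  shows "test_function (\<lambda>s. \<phi> (s - t))"
proof -
  have "(\<lambda>s. (deriv ^^ k) \<phi> (s - t)) differentiable_on UNIV" for k
  proof -
    have "(\<lambda>s. s - t) differentiable_on UNIV" by (intro derivative_intros)
    moreover have "(deriv ^^ k) \<phi> differentiable_on UNIV"
      using assms by (simp add: test_function_def smooth_def)
    ultimately show ?thesis
      using differentiable_on_compose[of "\<lambda>s. s - t" UNIV "(deriv ^^ k) \<phi>"]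
      by (auto intro: differentiable_on_subset)
  qed
  then have "smooth (\<lambda>s. \<phi> (s - t))" by (simp add: smooth_def higher_deriv_shift)
  moreover have "{s. \<phi> (s - t) \<noteq> 0} = (+) t ` {s. \<phi> s \<noteq> 0}"
    by (force simp: image_iff intro: exI[of _ "_ - t"])
  then have "compact (closure {s. \<phi> (s - t) \<noteq> 0})"
    using assms by (simp add: closure_translation test_function_def compact_translation)
  ultimately show ?thesis by (simp add: test_function_def)
qed

lemma integrable_mult_compact_support:
  fixes f g :: "real \<Rightarrow> real"
  assumes f: "locally_integrable f" and g: "continuous_on UNIV g"
    and supp: "\<And>s. s \<notin> {a..b} \<Longrightarrow> g s = 0"
  shows "integrable lebesgue (\<lambda>s. f s * g s)"
proof -
  obtain C where C: "\<And>s. s \<in> {a..b} \<Longrightarrow> \<bar>g s\<bar> \<le> C"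
    using continuous_on_interval_bounded continuous_on_subset[OF g subset_UNIV] by blast
  have "integrable lebesgue (\<lambda>s. indicator {a..b} s * f s)"
    using f by (simp add: locally_integrable_def set_integrable_def)
  then have int: "integrable lebesgue (\<lambda>s. C * (indicator {a..b} s * f s))"
    by simp
  have "g \<in> borel_measurable borel" using g by (rule borel_measurable_continuous_onI)
  then have gm: "g \<in> borel_measurable lebesgue"
    by (simp add: measurable_completion)
  have "(\<lambda>s. (indicator {a..b} s * f s) * g s) \<in> borel_measurable lebesgue"
    by (intro borel_measurable_times gm
        borel_measurable_integrable[OF \<open>integrable lebesgue (\<lambda>s. indicator {a..b} s * f s)\<close>])
  moreover have "(\<lambda>s. (indicator {a..b} s * f s) * g s) = (\<lambda>s. f s * g s)"
    using supp by (auto simp: fun_eq_iff indicator_def)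
  ultimately have "(\<lambda>s. f s * g s) \<in> borel_measurable lebesgue" by simp
  moreover have "norm (f s * g s) \<le> norm (C * (indicator {a..b} s * f s))" for s
  proof (cases "s \<in> {a..b}")
    case True
    then have "\<bar>g s\<bar> \<le> \<bar>C\<bar>" using C[of s] by linarith
    then have "\<bar>g s\<bar> * \<bar>f s\<bar> \<le> \<bar>C\<bar> * \<bar>f s\<bar>" by (rule mult_right_mono) simp
    with True show ?thesis by (simp add: abs_mult mult.commute)
  qed (simp add: supp)
  ultimately show ?thesis
    by (intro Bochner_Integration.integrable_bound[OF int]) auto
qed

lemma integrable_mult_translate:
  fixes f g :: "real \<Rightarrow> real"
  assumes "locally_integrable f" "continuous_on UNIV g" "\<And>x. 1 \<le> \<bar>x\<bar> \<Longrightarrow> g x = 0"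
  shows "integrable lebesgue (\<lambda>s. f s * g (s - t))"
proof (rule integrable_mult_compact_support[of _ _ "t - 1" "t + 1"])
  show "continuous_on UNIV (\<lambda>s. g (s - t))"
    by (intro continuous_on_compose2[OF assms(2)] continuous_intros) auto
qed (use assms in auto)

lemma bounded_continuous_compact_support:
  fixes g :: "real \<Rightarrow> real"
  assumes "continuous_on UNIV g" "\<And>x. 1 \<le> \<bar>x\<bar> \<Longrightarrow> g x = 0"
  obtains C where "\<And>x. \<bar>g x\<bar> \<le> C"
proof -
  obtain C where C: "\<And>s. s \<in> {-1..1} \<Longrightarrow> \<bar>g s\<bar> \<le> C"
    using continuous_on_interval_bounded continuous_on_subset[OF assms(1) subset_UNIV] by blast
  have "\<bar>g x\<bar> \<le> C" for x
    using C[of x] C[of 1] assms(2)[of x] by (cases "\<bar>x\<bar> \<le> 1") (auto simp: abs_le_iff)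
  then show thesis by (rule that)
qed

text \<open>Differentiation under the integral sign, with all derivatives falling on the kernel. The
  difference quotients of \<open>g\<close> are bounded by a Lipschitz constant and, along a convergent sequence of
  base points, vanish outside one fixed interval, where \<open>f\<close> is integrable.\<close>

lemma has_real_derivative_mollification:
  fixes f g g' :: "real \<Rightarrow> real"
  assumes f: "locally_integrable f"
    and deriv: "\<And>x. (g has_real_derivative g' x) (at x)"
    and cont: "continuous_on UNIV g'"
    and g0: "\<And>x. 1 \<le> \<bar>x\<bar> \<Longrightarrow> g x = 0" and g'0: "\<And>x. 1 \<le> \<bar>x\<bar> \<Longrightarrow> g' x = 0"
  shows "((\<lambda>t. \<integral>s. f s * g (s - t) \<partial>lebesgue) has_real_derivative
           - (\<integral>s. f s * g' (s - t) \<partial>lebesgue)) (at t)"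
proof -
  have gc: "continuous_on UNIV g"
    using deriv by (auto intro!: continuous_at_imp_continuous_on DERIV_isCont)
  obtain C where C: "\<And>x. \<bar>g' x\<bar> \<le> C"
    using bounded_continuous_compact_support[OF cont g'0] by blast
  have lip: "\<bar>g x - g y\<bar> \<le> C * \<bar>x - y\<bar>" for x y
    using field_differentiable_bound[of UNIV g g' C x y] deriv C by auto
  note int = integrable_mult_translate[OF f gc g0]
  note int' = integrable_mult_translate[OF f cont g'0]
  have "((\<lambda>r. ((\<integral>s. f s * g (s - r) \<partial>lebesgue) - (\<integral>s. f s * g (s - t) \<partial>lebesgue)) / (r - t))
        \<longlongrightarrow> - (\<integral>s. f s * g' (s - t) \<partial>lebesgue)) (at t)"
    unfolding tendsto_at_iff_sequentially
  proof (intro allI impI)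
    fix X :: "nat \<Rightarrow> real"
    assume "\<forall>i. X i \<in> UNIV - {t}" and lim: "X \<longlonglongrightarrow> t"
    then have ne: "X i \<noteq> t" for i by simp
    obtain K where K: "\<And>i. \<bar>X i - t\<bar> \<le> K"
    proof -
      have "(\<lambda>i. X i - t) \<longlonglongrightarrow> t - t" using lim by (intro tendsto_intros)
      then have "Bseq (\<lambda>i. X i - t)" by (intro convergent_imp_Bseq convergentI)
      then show thesis using that by (auto simp: Bseq_def)
    qed
    \<comment> \<open>\<open>K\<close> bounds the displacements, so every difference quotient lives on the interval in \<open>m\<close>.\<close>
    define q where "q i s = f s * ((g (s - X i) - g (s - t)) / (X i - t))" for i s
    define m where "m s = C * \<bar>indicator {t - 1 - K..t + 1 + K} s * f s\<bar>" for s
    have "integrable lebesgue (\<lambda>s. indicator {t - 1 - K..t + 1 + K} s * f s)"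
      using f by (simp add: locally_integrable_def set_integrable_def)
    then have m: "integrable lebesgue m" unfolding m_def by simp
    have qint: "integrable lebesgue (q i)" for i
    proof -
      have "integrable lebesgue (\<lambda>s. (f s * g (s - X i) - f s * g (s - t)) / (X i - t))"
        using int by simp
      then show ?thesis unfolding q_def by (simp add: algebra_simps)
    qed
    have "(\<lambda>i. integral\<^sup>L lebesgue (q i)) \<longlonglongrightarrow> (\<integral>s. - (f s * g' (s - t)) \<partial>lebesgue)"
    proof (rule integral_dominated_convergence[where w = m])
      show "AE s in lebesgue. (\<lambda>i. q i s) \<longlonglongrightarrow> - (f s * g' (s - t))"
      proof (rule AE_I2)
        fix s
        have "((\<lambda>r. g (s - r)) has_real_derivative g' (s - t) * - 1) (at t)"
          by (rule DERIV_chain2[OF deriv]) (auto intro!: derivative_eq_intros)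
        then have "((\<lambda>r. (g (s - r) - g (s - t)) / (r - t)) \<longlongrightarrow> - g' (s - t)) (at t)"
          by (simp add: has_field_derivative_iff)
        then have "(\<lambda>i. (g (s - X i) - g (s - t)) / (X i - t)) \<longlonglongrightarrow> - g' (s - t)"
          unfolding tendsto_at_iff_sequentially using ne lim by (auto simp: comp_def)
        from tendsto_mult_left[OF this, of "f s"]
        show "(\<lambda>i. q i s) \<longlonglongrightarrow> - (f s * g' (s - t))" by (simp add: q_def)
      qed
      show "AE s in lebesgue. norm (q i s) \<le> m s" for i
      proof (rule AE_I2)
        fix s
        show "norm (q i s) \<le> m s"
        proof (cases "s \<in> {t - 1 - K..t + 1 + K}")
          case True
          have "\<bar>(g (s - X i) - g (s - t)) / (X i - t)\<bar> \<le> C"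
            using lip[of "s - X i" "s - t"] ne[of i] by (simp add: divide_le_eq abs_minus_commute)
          from mult_left_mono[OF this, of "\<bar>f s\<bar>"] True show ?thesis
            by (simp add: q_def m_def abs_mult mult.commute)
        next
          case False
          then have "1 \<le> \<bar>s - X i\<bar>" "1 \<le> \<bar>s - t\<bar>" using K[of i] by auto
          then show ?thesis using C[of 0] by (simp add: q_def m_def g0)
        qed
      qed
    qed (use int' qint m in auto)
    moreover have "integral\<^sup>L lebesgue (q i) =
        ((\<integral>s. f s * g (s - X i) \<partial>lebesgue) - (\<integral>s. f s * g (s - t) \<partial>lebesgue)) / (X i - t)" for i
    proof -
      have "q i = (\<lambda>s. (f s * g (s - X i) - f s * g (s - t)) / (X i - t))"
        by (auto simp: q_def algebra_simps)
      then show ?thesis using int by simp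
    qed
    ultimately show "((\<lambda>r. ((\<integral>s. f s * g (s - r) \<partial>lebesgue) - (\<integral>s. f s * g (s - t) \<partial>lebesgue)) / (r - t)) \<circ> X)
        \<longlonglongrightarrow> - (\<integral>s. f s * g' (s - t) \<partial>lebesgue)"
      by (simp add: comp_def)
  qed
  then show ?thesis by (simp add: has_field_derivative_iff)
qed

text \<open>Young's inequality \<open>\<bar>f g\<bar> \<le> f\<^sup>2 + g\<^sup>2\<close> gives a bound whose second part does not see the
  translation.\<close>

lemma mollification_bounded:
  fixes f g :: "real \<Rightarrow> real"
  assumes f: "square_integrable f" and loc: "locally_integrable f"
    and g: "continuous_on UNIV g" "\<And>x. 1 \<le> \<bar>x\<bar> \<Longrightarrow> g x = 0"
  shows "\<exists>B. \<forall>t. \<bar>\<integral>s. f s * g (s - t) \<partial>lebesgue\<bar> \<le> B"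
proof -
  obtain C where C: "\<And>x. \<bar>g x\<bar> \<le> C"
    using bounded_continuous_compact_support[OF g] by blast
  have "\<bar>\<integral>s. f s * g (s - t) \<partial>lebesgue\<bar> \<le> (\<integral>s. (f s)\<^sup>2 \<partial>lebesgue) + C\<^sup>2 * 2" for t
  proof -
    have int: "integrable lebesgue (\<lambda>s. (f s)\<^sup>2)" "integrable lebesgue (\<lambda>s. C\<^sup>2 * indicator {t-1..t+1} s)"
      using f by (auto simp: square_integrable_def)
    have pt: "\<bar>f s * g (s - t)\<bar> \<le> (f s)\<^sup>2 + C\<^sup>2 * indicator {t-1..t+1} s" for s
    proof -
      have "2 * (\<bar>f s\<bar> * \<bar>g (s - t)\<bar>) \<le> \<bar>f s\<bar>\<^sup>2 + \<bar>g (s - t)\<bar>\<^sup>2"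
        using sum_squares_bound[of "\<bar>f s\<bar>" "\<bar>g (s - t)\<bar>"] by simp
      moreover have "\<bar>g (s - t)\<bar>\<^sup>2 \<le> C\<^sup>2 * indicator {t-1..t+1} s"
      proof (cases "s \<in> {t-1..t+1}")
        case True
        have "\<bar>g (s - t)\<bar>\<^sup>2 \<le> C\<^sup>2" using C by (intro power_mono) auto
        with True show ?thesis by simp
      qed (auto simp: g(2))
      ultimately show ?thesis
        using zero_le_power2[of "f s"] by (simp add: abs_mult)
          (smt (verit) abs_ge_zero mult_nonneg_nonneg)
    qed
    have "\<bar>\<integral>s. f s * g (s - t) \<partial>lebesgue\<bar> \<le> (\<integral>s. \<bar>f s * g (s - t)\<bar> \<partial>lebesgue)"
      by (rule integral_abs_bound)
    also have "\<dots> \<le> (\<integral>s. (f s)\<^sup>2 + C\<^sup>2 * indicator {t-1..t+1} s \<partial>lebesgue)"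
      using int pt integrable_mult_translate[OF loc g] by (intro integral_mono) auto
    also have "\<dots> = (\<integral>s. (f s)\<^sup>2 \<partial>lebesgue) + C\<^sup>2 * 2"
      using int by simp
    finally show ?thesis .
  qed
  then show ?thesis by blast
qed

text \<open>The kernel is written as \<open>\<phi> (s - t)\<close>, a translate of \<open>\<phi>\<close>: differentiating it in \<open>s\<close> produces no
  sign, and the only sign is that of the definition of a weak derivative.\<close>

lemma weak_derivative_mollification:
  assumes "weak_derivative k f g" "test_function \<phi>"
  shows "(-1) ^ k * (\<integral>s. f s * (deriv ^^ k) \<phi> (s - t) \<partial>lebesgue) = (\<integral>s. g s * \<phi> (s - t) \<partial>lebesgue)"
  using assms(1) test_function_shift[OF assms(2), of t]
  by (auto simp: weak_derivative_def higher_deriv_shift power_mult_distrib[symmetric] simp flip: mult.assoc)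

section \<open>A comparison principle for a fourth order inequality\<close>

text \<open>Write \<open>z'' - r\<^sup>2 z = (D - r) (D + r) z\<close>. The function \<open>h = z' + r z\<close> satisfies \<open>h' \<le> r h\<close>, so
  \<open>exp (- r t) h\<close> is nonincreasing, and a single negative value of \<open>h\<close> would force \<open>h\<close> to tend to
  \<open>-\<infinity>\<close> exponentially.\<close>

lemma first_order_factor_nonneg:
  fixes z z' z'' :: "real \<Rightarrow> real"
  assumes z: "\<And>t. (z has_real_derivative z' t) (at t)"
    and z': "\<And>t. (z' has_real_derivative z'' t) (at t)"
    and bz: "\<And>t. \<bar>z t\<bar> \<le> B" and bz': "\<And>t. \<bar>z' t\<bar> \<le> B"
    and r: "0 < r" and le: "\<And>t. z'' t \<le> r\<^sup>2 * z t"
  shows "0 \<le> z' t + r * z t"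
proof (rule ccontr)
  define h where "h t = z' t + r * z t" for t
  assume "\<not> 0 \<le> z' t + r * z t"
  then have neg: "h t < 0" by (simp add: h_def)
  have dec: "exp (- r * y) * h y \<le> exp (- r * x) * h x" if "x \<le> y" for x y
  proof (rule DERIV_nonpos_imp_nonincreasing[OF that])
    fix s
    have "((\<lambda>s. exp (- r * s) * h s) has_real_derivative
        exp (- r * s) * (z'' s - r\<^sup>2 * z s)) (at s)"
      unfolding h_def
      by (auto intro!: derivative_eq_intros z z' simp: algebra_simps power2_eq_square)
    moreover have "exp (- r * s) * (z'' s - r\<^sup>2 * z s) \<le> 0"
      using le[of s] by (simp add: mult_le_0_iff)
    ultimately show "\<exists>y. ((\<lambda>s. exp (- r * s) * h s) has_real_derivative y) (at s) \<and> y \<le> 0"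
      by blast
  qed
  have growth: "- (B + r * B) \<le> exp (r * x) * h t" if "0 \<le> x" for x
  proof -
    have "h (t + x) = exp (r * (t + x)) * (exp (- r * (t + x)) * h (t + x))"
      by (simp add: mult.assoc[symmetric] exp_add[symmetric])
    also have "\<dots> \<le> exp (r * (t + x)) * (exp (- r * t) * h t)"
      using dec[of t "t + x"] that by (intro mult_left_mono) auto
    also have "\<dots> = exp (r * x) * h t"
      by (simp add: mult.assoc[symmetric] exp_add[symmetric] algebra_simps)
    finally have "h (t + x) \<le> exp (r * x) * h t" .
    moreover have "- (B + r * B) \<le> h (t + x)"
    proof -
      have "- (r * B) \<le> r * z (t + x)"
        using mult_left_mono[of "- B" "z (t + x)" r] bz[of "t + x"] r by simp
      then show ?thesis using bz'[of "t + x"] by (simp add: h_def)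
    qed
    ultimately show ?thesis by linarith
  qed
  \<comment> \<open>At this \<open>x\<close> the linear lower bound \<open>1 + r x\<close> of \<open>exp (r x)\<close> already exceeds what \<open>growth\<close> permits.\<close>
  define x where "x = (B + r * B) / (r * - h t)"
  have B: "0 \<le> B" using bz[of 0] by linarith
  have x: "0 \<le> x" unfolding x_def using B r neg by (intro divide_nonneg_pos add_nonneg_nonneg mult_nonneg_nonneg mult_pos_pos) auto
  have "exp (r * x) * h t \<le> (1 + r * x) * h t"
    using neg by (intro mult_right_mono_neg) auto
  moreover have "(1 + r * x) * h t = h t - (B + r * B)"
    using neg r by (simp add: x_def field_simps)
  moreover note growth[OF x] neg
  ultimately show False by simp
qed

text \<open>The reflection \<open>t \<mapsto> - t\<close> turns the preceding lemma into \<open>z' \<le> r z\<close>; adding the two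
  inequalities eliminates \<open>z'\<close>.\<close>

lemma bounded_supersolution_nonneg:
  fixes z z' z'' :: "real \<Rightarrow> real"
  assumes z: "\<And>t. (z has_real_derivative z' t) (at t)"
    and z': "\<And>t. (z' has_real_derivative z'' t) (at t)"
    and bz: "\<And>t. \<bar>z t\<bar> \<le> B" and bz': "\<And>t. \<bar>z' t\<bar> \<le> B"
    and r: "0 < r" and le: "\<And>t. z'' t \<le> r\<^sup>2 * z t"
  shows "0 \<le> z t"
proof -
  have "((\<lambda>t. z (- t)) has_real_derivative - z' (- t)) (at t)" for t
    using DERIV_chain2[OF z DERIV_minus[OF DERIV_ident], of t UNIV] by simp
  moreover have "((\<lambda>t. - z' (- t)) has_real_derivative z'' (- t)) (at t)" for t
    using DERIV_minus[OF DERIV_chain2[OF z' DERIV_minus[OF DERIV_ident], of t UNIV]] by simp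
  ultimately have "0 \<le> - z' (- (- t)) + r * z (- (- t))"
    using bz bz' r le by (intro first_order_factor_nonneg[where B = B and z'' = "\<lambda>t. z'' (- t)"]) auto
  moreover have "0 \<le> z' t + r * z t"
    using assms by (intro first_order_factor_nonneg)
  ultimately have "0 \<le> r * z t" by simp
  then show ?thesis using r by (simp add: zero_le_mult_iff)
qed

text \<open>The operator factors as \<open>(D\<^sup>2 - r\<^sup>2) (D\<^sup>2 - s\<^sup>2)\<close>. Applied to \<open>z = r\<^sup>2 V - V''\<close>, a bounded function
  with \<open>z'' \<le> s\<^sup>2 z\<close>, the comparison principle yields \<open>V'' \<le> r\<^sup>2 V\<close>. Applied once more, to \<open>V\<close>, its
  first order form yields \<open>V' + r V \<ge> 0\<close>, which says that \<open>exp (r t) V t\<close> is nondecreasing. The roots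
  \<open>r\<close> and \<open>s\<close> enter symmetrically, so the smaller one may be chosen as \<open>r\<close>.\<close>

lemma fourth_order_lower_bound:
  fixes V :: "nat \<Rightarrow> real \<Rightarrow> real"
  assumes deriv: "\<And>k t. (V k has_real_derivative V (Suc k) t) (at t)"
    and bdd: "\<And>k. \<exists>B. \<forall>t. \<bar>V k t\<bar> \<le> B"
    and r: "0 < r" and s: "0 < s"
    and ineq: "\<And>t. 0 \<le> V 4 t - (r\<^sup>2 + s\<^sup>2) * V 2 t + r\<^sup>2 * s\<^sup>2 * V 0 t"
    and t: "0 \<le> t"
  shows "V 0 0 * exp (- r * t) \<le> V 0 t"
proof -
  have D: "(V 0 has_real_derivative V 1 t) (at t)" "(V 1 has_real_derivative V 2 t) (at t)"
    "(V 2 has_real_derivative V 3 t) (at t)" "(V 3 has_real_derivative V 4 t) (at t)" for t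
    using deriv[of 0] deriv[of 1] deriv[of 2] deriv[of 3] by (simp_all add: eval_nat_numeral)
  obtain B where B: "\<And>k t. k \<in> {0,1,2,3} \<Longrightarrow> \<bar>V k t\<bar> \<le> B"
  proof -
    obtain f where f: "\<And>k t. \<bar>V k t\<bar> \<le> f k" using bdd by metis
    show thesis
    proof (rule that)
      fix k :: nat and t assume "k \<in> {0,1,2,3}"
      then have "f k \<le> Max (f ` {0,1,2,3})" by (intro Max_ge) auto
      then show "\<bar>V k t\<bar> \<le> Max (f ` {0,1,2,3})" using f[of k t] by linarith
    qed
  qed
  have comb: "\<bar>r\<^sup>2 * x - y\<bar> \<le> r\<^sup>2 * B + B" if "\<bar>x\<bar> \<le> B" "\<bar>y\<bar> \<le> B" for x y
  proof -
    have "\<bar>r\<^sup>2 * x\<bar> \<le> r\<^sup>2 * B" using that(1) by (simp add: abs_mult mult_left_mono)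
    then show ?thesis using that(2) by linarith
  qed
  have z: "0 \<le> r\<^sup>2 * V 0 t - V 2 t" for t
  proof (rule bounded_supersolution_nonneg[where r = s and B = "r\<^sup>2 * B + B"
        and z = "\<lambda>t. r\<^sup>2 * V 0 t - V 2 t" and z' = "\<lambda>t. r\<^sup>2 * V 1 t - V 3 t" and z'' = "\<lambda>t. r\<^sup>2 * V 2 t - V 4 t"])
    show "r\<^sup>2 * V 2 t - V 4 t \<le> s\<^sup>2 * (r\<^sup>2 * V 0 t - V 2 t)" for t
      using ineq[of t] by (simp add: algebra_simps)
  qed (use s in \<open>auto intro!: derivative_eq_intros D D(2)[unfolded One_nat_def] comb B B[unfolded One_nat_def]\<close>)
  have h: "0 \<le> V 1 t + r * V 0 t" for t
    by (rule first_order_factor_nonneg[where B = B, OF D(1) D(2)]) (use z r B in auto)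
  have "exp (r * 0) * V 0 0 \<le> exp (r * t) * V 0 t"
  proof (rule DERIV_nonneg_imp_nondecreasing[OF t])
    fix x
    have "((\<lambda>x. exp (r * x) * V 0 x) has_real_derivative exp (r * x) * (V 1 x + r * V 0 x)) (at x)"
      by (auto intro!: derivative_eq_intros D simp: algebra_simps)
    then show "\<exists>y. ((\<lambda>x. exp (r * x) * V 0 x) has_real_derivative y) (at x) \<and> 0 \<le> y"
      using h[of x] by (metis exp_ge_zero mult_nonneg_nonneg)
  qed
  then show ?thesis by (simp add: exp_minus field_simps)
qed

text \<open>Mollifying a weak solution keeps the linear left-hand side and turns the right-hand side, which
  is nonnegative, into a nonnegative function. The mollification is smooth and bounded together with
  all its derivatives, so it has the lower bound of \<open>fourth_order_lower_bound\<close>. Monotonicity carries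
  the bound back to \<open>v\<close>: averages of \<open>v\<close> over \<open>[t, t + 2]\<close> are at most a multiple of \<open>v t\<close>.\<close>

lemma weak_solution_exponential_lower_bound:
  fixes v :: "real \<Rightarrow> real"
  assumes sq: "square_integrable v" and sol: "weak_solution (r\<^sup>2 + s\<^sup>2) (r\<^sup>2 * s\<^sup>2) q v"
    and r: "0 < r" and s: "0 < s"
    and pos: "\<And>t. 0 < v t" and mono: "antimono_on {0<..} v"
  shows "\<exists>c>0. \<forall>t>0. c * exp (- r * t) \<le> v t"
proof -
  obtain v2 v4 where w2: "weak_derivative 2 v v2" and w4: "weak_derivative 4 v v4"
    and eq: "AE t in lebesgue. v4 t - (r\<^sup>2 + s\<^sup>2) * v2 t + r\<^sup>2 * s\<^sup>2 * v t = v t powr q"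
    using sol by (auto simp: weak_solution_def)
  have loc: "locally_integrable v" "locally_integrable v2" "locally_integrable v4"
    using w2 w4 by (auto simp: weak_derivative_def)
  define \<phi> where "\<phi> = bump 1 0"
  define \<Phi> where "\<Phi> k = (deriv ^^ k) \<phi>" for k
  \<comment> \<open>The sign makes \<open>V k\<close> the \<open>k\<close>-th derivative of \<open>V 0\<close>, since the kernel is differentiated in \<open>t\<close>.\<close>
  define V where "V k t = (-1) ^ k * (\<integral>x. v x * \<Phi> k (x - t) \<partial>lebesgue)" for k t
  note \<Phi>_props = higher_deriv_bump_props[folded \<phi>_def, folded \<Phi>_def]
  have \<phi>: "continuous_on UNIV \<phi>" "\<And>x. 1 \<le> \<bar>x\<bar> \<Longrightarrow> \<phi> x = 0"
    using \<Phi>_props(2)[of 0] \<Phi>_props(3)[where k = 0] by (auto simp: \<Phi>_def)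
  have \<phi>_nonneg: "0 \<le> \<phi> x" for x by (simp add: \<phi>_def bump_def)
  have \<phi>_pos: "0 < \<phi> x" if "\<bar>x\<bar> < 1" for x using that by (simp add: \<phi>_def bump_def)
  note int = integrable_mult_translate[OF _ \<phi>]
  have V0: "V 0 t = (\<integral>x. v x * \<phi> (x - t) \<partial>lebesgue)" for t
    by (simp add: V_def \<Phi>_def)
  have deriv: "(V k has_real_derivative V (Suc k) t) (at t)" for k t
  proof -
    have "((\<lambda>t. \<integral>x. v x * \<Phi> k (x - t) \<partial>lebesgue) has_real_derivative
        - (\<integral>x. v x * \<Phi> (Suc k) (x - t) \<partial>lebesgue)) (at t)"
      by (rule has_real_derivative_mollification[OF loc(1) \<Phi>_props(1,2) \<Phi>_props(3) \<Phi>_props(3)])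
    from DERIV_cmult[OF this, of "(-1) ^ k"] show ?thesis
      unfolding V_def by simp
  qed
  have bdd: "\<exists>B. \<forall>t. \<bar>V k t\<bar> \<le> B" for k
    using mollification_bounded[OF sq loc(1) \<Phi>_props(2) \<Phi>_props(3)]
    by (simp add: V_def abs_mult power_abs)
  have ineq: "0 \<le> V 4 t - (r\<^sup>2 + s\<^sup>2) * V 2 t + r\<^sup>2 * s\<^sup>2 * V 0 t" for t
  proof -
    have V24: "V 2 t = (\<integral>x. v2 x * \<phi> (x - t) \<partial>lebesgue)" "V 4 t = (\<integral>x. v4 x * \<phi> (x - t) \<partial>lebesgue)"
      using weak_derivative_mollification[OF w2 test_function_bump, of t]
        weak_derivative_mollification[OF w4 test_function_bump, of t]
      by (simp_all only: V_def \<Phi>_def \<phi>_def)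
    have "V 4 t - (r\<^sup>2 + s\<^sup>2) * V 2 t + r\<^sup>2 * s\<^sup>2 * V 0 t
        = (\<integral>x. v4 x * \<phi> (x - t) - (r\<^sup>2 + s\<^sup>2) * (v2 x * \<phi> (x - t)) + r\<^sup>2 * s\<^sup>2 * (v x * \<phi> (x - t)) \<partial>lebesgue)"
      unfolding V24 V0 using int[OF loc(1)] int[OF loc(2)] int[OF loc(3)] by simp
    also have "\<dots> \<ge> 0"
    proof (rule integral_nonneg_AE)
      show "AE x in lebesgue. 0 \<le> v4 x * \<phi> (x - t) - (r\<^sup>2 + s\<^sup>2) * (v2 x * \<phi> (x - t))
          + r\<^sup>2 * s\<^sup>2 * (v x * \<phi> (x - t))"
        using eq
      proof eventually_elim
        case (elim x)
        have "0 \<le> v x powr q * \<phi> (x - t)" using \<phi>_nonneg by simp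
        then show ?case unfolding elim[symmetric] by (simp add: algebra_simps)
      qed
    qed
    finally show ?thesis .
  qed
  have V_pos: "0 < V 0 0"
  proof -
    have i: "integrable lebesgue (\<lambda>x. v x * \<phi> x)" using int[OF loc(1), of 0] by simp
    have nn: "0 \<le> v x * \<phi> x" for x using pos[of x] \<phi>_nonneg[of x] by simp
    have "V 0 0 \<noteq> 0"
    proof
      assume "V 0 0 = 0"
      then have "AE x in lebesgue. v x * \<phi> x = 0"
        using integral_nonneg_eq_0_iff_AE[OF i] nn by (simp add: V0)
      then have "AE x in lebesgue. x \<notin> {-1<..<1::real}"
      proof eventually_elim
        case (elim x)
        show ?case
        proof
          assume "x \<in> {-1<..<1}"
          then have "0 < v x * \<phi> x" using pos[of x] \<phi>_pos[of x] by (intro mult_pos_pos) auto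
          with elim show False by linarith
        qed
      qed
      moreover have "{-1<..<1::real} \<in> sets lebesgue" by (intro borel_open sets_completionI_sets) auto
      ultimately have "{-1<..<1::real} \<in> null_sets lebesgue" using AE_iff_null_sets by blast
      then have "emeasure lebesgue {-1<..<1::real} = 0" by (rule null_setsD1)
      then show False by simp
    qed
    moreover have "0 \<le> V 0 0" unfolding V0 using nn by simp
    ultimately show ?thesis by simp
  qed
  obtain C where C: "\<And>x. \<bar>\<phi> x\<bar> \<le> C"
    using bounded_continuous_compact_support[OF \<phi>] by blast
  have C_pos: "0 < C" using C[of 0] \<phi>_pos[of 0] by simp
  have upper: "V 0 (t + 1) \<le> v t * C * 2" if t: "0 < t" for t
  proof -
    have "V 0 (t + 1) \<le> (\<integral>x. v t * C * indicator {t..t+2} x \<partial>lebesgue)"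
      unfolding V0
    proof (rule integral_mono)
      fix x
      show "v x * \<phi> (x - (t + 1)) \<le> v t * C * indicator {t..t + 2} x"
      proof (cases "x \<in> {t..t+2}")
        case True
        then have "v x \<le> v t" using mono t by (auto simp: monotone_on_def)
        moreover have "\<phi> (x - (t + 1)) \<le> C" using C[of "x - (t + 1)"] by simp
        ultimately have "v x * \<phi> (x - (t + 1)) \<le> v t * C"
          using \<phi>_nonneg pos[of t] by (intro mult_mono) auto
        with True show ?thesis by simp
      next
        case False
        then have "1 \<le> \<bar>x - (t + 1)\<bar>" by auto
        with False \<phi>(2) show ?thesis by simp
      qed
    qed (use int[OF loc(1)] in auto)
    then show ?thesis by simp
  qed
  \<comment> \<open>The factor \<open>exp (- r)\<close> is the cost of the shift by \<open>1\<close> in \<open>upper\<close>.\<close>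
  define c where "c = V 0 0 * exp (- r) / (2 * C)"
  have "c * exp (- r * t) \<le> v t" if "0 < t" for t
  proof -
    have "V 0 0 * exp (- r * (t + 1)) \<le> v t * C * 2"
      using fourth_order_lower_bound[OF deriv bdd r s ineq, of "t + 1"] upper[OF that] that by simp
    moreover have "exp (- r * (t + 1)) = exp (- r) * exp (- r * t)"
      by (simp add: exp_add[symmetric] algebra_simps)
    ultimately show ?thesis
      using C_pos by (simp add: c_def field_simps)
  qed
  moreover have "0 < c" using V_pos C_pos by (simp add: c_def)
  ultimately show ?thesis by blast
qed

section \<open>The characteristic roots and the singularity\<close>

text \<open>Let \<open>P X = X\<^sup>2 - K2 X + K0\<close>. A direct computation gives \<open>P (g\<^sup>2) = \<mu> \<ge> 0\<close>, so \<open>g\<^sup>2\<close> does not lie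
  strictly between the roots \<open>r\<^sup>2 < s\<^sup>2\<close> of \<open>P\<close>; the bound on \<open>lam\<close> makes the discriminant positive
  and puts \<open>g\<^sup>2\<close> to the right of the midpoint \<open>K2 / 2\<close>, hence strictly to the right of the smaller
  root.\<close>

lemma characteristic_roots:
  fixes g d lam \<mu> K0 K2 :: real
  assumes K2: "K2 = g\<^sup>2 + d\<^sup>2 - lam" and K0: "K0 = g\<^sup>2 * d\<^sup>2 - lam * g\<^sup>2 + \<mu>"
    and pos: "0 < K0" "0 < K2" "0 < g" and \<mu>: "0 \<le> \<mu>"
    and lam: "d\<^sup>2 - g\<^sup>2 + 2 * sqrt \<mu> < lam"
  obtains r s where "0 < r" "0 < s" "r\<^sup>2 + s\<^sup>2 = K2" "r\<^sup>2 * s\<^sup>2 = K0" "r < g"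
proof -
  \<comment> \<open>The identity \<open>4 P X = (2 X - K2)\<^sup>2 - (K2\<^sup>2 - 4 K0)\<close> at \<open>X = g\<^sup>2\<close> gives \<open>disc\<close>.\<close>
  define L where "L = 2 * g\<^sup>2 - K2"
  have L: "2 * sqrt \<mu> < L" using lam by (simp add: L_def K2)
  have disc: "K2\<^sup>2 - 4 * K0 = L\<^sup>2 - 4 * \<mu>"
    unfolding L_def K2 K0 by (simp add: algebra_simps power2_eq_square)
  have "(2 * sqrt \<mu>)\<^sup>2 < L\<^sup>2" using L \<mu> by (intro power_strict_mono) auto
  then have disc_pos: "0 < K2\<^sup>2 - 4 * K0" using \<mu> disc by (simp add: power_mult_distrib)
  define D where "D = sqrt (K2\<^sup>2 - 4 * K0)"
  have D: "0 < D" "D\<^sup>2 = K2\<^sup>2 - 4 * K0" using disc_pos by (auto simp: D_def)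
  have "D < K2" using D pos by (intro power2_less_imp_less[of D K2]) auto
  define r s where "r = sqrt ((K2 - D) / 2)" and "s = sqrt ((K2 + D) / 2)"
  have rs: "r\<^sup>2 = (K2 - D) / 2" "s\<^sup>2 = (K2 + D) / 2" "0 < r" "0 < s"
    using \<open>D < K2\<close> D pos by (auto simp: r_def s_def)
  have "r\<^sup>2 * s\<^sup>2 = (K2\<^sup>2 - D\<^sup>2) / 4" unfolding rs by (simp add: field_simps power2_eq_square)
  then have "r\<^sup>2 * s\<^sup>2 = K0" unfolding D(2) by simp
  moreover have "r\<^sup>2 + s\<^sup>2 = K2" unfolding rs by (simp add: field_simps)
  moreover have "r < g"
  proof (rule power2_less_imp_less)
    have "0 < L" using L real_sqrt_ge_zero[OF \<mu>] by linarith
    then show "r\<^sup>2 < g\<^sup>2" using D unfolding rs L_def by simp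
  qed (use pos in simp)
  ultimately show thesis using rs(3,4) by (intro that[of r s])
qed

lemma filterlim_norm_powr_at_top:
  fixes c e :: real
  assumes "0 < c" "e < 0"
  shows "filterlim (\<lambda>x :: 'a :: real_normed_vector. c * norm x powr e) at_top (at 0)"
proof -
  have "filterlim (\<lambda>y::real. - ln y) at_top (at_right 0)"
    using ln_at_0 by (simp add: filterlim_uminus_at_top)
  then have "filterlim (\<lambda>y::real. (- e) * (- ln y)) at_top (at_right 0)"
    using assms by (intro filterlim_tendsto_pos_mult_at_top[OF tendsto_const]) auto
  then have "filterlim (\<lambda>y::real. exp (e * ln y)) at_top (at_right 0)"
    by (intro filterlim_compose[OF exp_at_top]) simp
  then have "filterlim (\<lambda>y::real. c * exp (e * ln y)) at_top (at_right 0)"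
    using assms by (intro filterlim_tendsto_pos_mult_at_top[OF tendsto_const]) auto
  moreover have "\<forall>\<^sub>F y in at_right (0::real). c * exp (e * ln y) = c * y powr e"
    by (rule eventually_at_right_less[THEN eventually_mono]) (simp add: powr_def)
  ultimately have "filterlim (\<lambda>y::real. c * y powr e) at_top (at_right 0)"
    by (simp add: filterlim_cong[OF refl refl])
  moreover have "filterlim norm (at_right 0) (at (0::'a))"
    unfolding filterlim_at by (auto intro!: tendsto_eq_intros simp: eventually_at_filter)
  ultimately show ?thesis by (rule filterlim_compose)
qed

theorem proposition2p4:
  fixes n :: nat and \<alpha> \<beta> p lam \<mu> K0 K2 :: real and v u :: "real \<Rightarrow> real"
  assumes "5 \<le> n" and "n = CARD('n::finite)"
    and "- real n < \<alpha>" and "\<alpha> \<le> -2" and "1 < p"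
    and "(real n + \<alpha>) / 2 + (real n + \<beta>) / (p + 1) = real n - 2"
    and "0 \<le> \<mu>"
    and "(real n - 2) * (2 + \<alpha>) + 2 * sqrt \<mu> < lam"
    and "K2 = ((real n - 2)\<^sup>2 + (\<alpha> + 2)\<^sup>2) / 2 - lam"
    and "K0 = (real n - 4 - \<alpha>)\<^sup>2 * (real n + \<alpha>)\<^sup>2 / 16
                - lam * ((real n - 4 - \<alpha>) / 2)\<^sup>2 + \<mu>"
    and "0 < K0" and "0 < K2"
    and "v \<in> sobolev_H2"
    and "weak_solution K2 K0 p v"
    and "\<forall>t. 0 < v t"
    and "\<forall>t. v (- t) = v t"
    and "strict_antimono_on {0<..} v"
    and "\<forall>x::real^'n. x \<noteq> 0 \<longrightarrow>
           u (norm x) = norm x powr (- ((real n - 4 - \<alpha>) / 2)) * v (- ln (norm x))"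
  shows "filterlim (\<lambda>x::real^'n. u (norm x)) at_top (at 0)"
proof -
  define g d where "g = (real n - 4 - \<alpha>) / 2" and "d = (real n + \<alpha>) / 2"
  have g_pos: "0 < g" using assms(1,4) by (simp add: g_def)
  have K2: "K2 = g\<^sup>2 + d\<^sup>2 - lam" and K0: "K0 = g\<^sup>2 * d\<^sup>2 - lam * g\<^sup>2 + \<mu>"
    unfolding assms(9,10) g_def d_def by (simp_all add: field_simps power2_eq_square)
  have "d\<^sup>2 - g\<^sup>2 = (real n - 2) * (2 + \<alpha>)"
    unfolding g_def d_def by (simp add: field_simps power2_eq_square)
  then obtain r s where rs: "0 < r" "0 < s" "r\<^sup>2 + s\<^sup>2 = K2" "r\<^sup>2 * s\<^sup>2 = K0" "r < g"
    using characteristic_roots[OF K2 K0 assms(11,12) g_pos assms(7)] assms(8) by metis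
  have "square_integrable v" using assms(13) by (simp add: sobolev_H2_def)
  moreover have "antimono_on {0<..} v"
    using assms(17) by (auto simp: monotone_on_def order_le_less)
  ultimately obtain c where c: "0 < c" "\<And>t. 0 < t \<Longrightarrow> c * exp (- r * t) \<le> v t"
    using weak_solution_exponential_lower_bound[of v r s p] rs assms(14,15) by auto
  have "filterlim (\<lambda>x::real^'n. c * norm x powr (r - g)) at_top (at 0)"
    using c(1) rs(5) by (intro filterlim_norm_powr_at_top) auto
  moreover have "\<forall>\<^sub>F x::real^'n in at 0. c * norm x powr (r - g) \<le> u (norm x)"
    unfolding eventually_at
  proof (intro exI[of _ 1] conjI ballI impI)
    fix x :: "real^'n" assume x: "x \<noteq> 0 \<and> dist x 0 < 1"
    then have "c * exp (- r * - ln (norm x)) \<le> v (- ln (norm x))" by (intro c(2)) auto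
    then have "norm x powr (- g) * (c * exp (r * ln (norm x))) \<le> norm x powr (- g) * v (- ln (norm x))"
      by (intro mult_left_mono) auto
    also have "\<dots> = u (norm x)" using assms(18) x by (simp add: g_def)
    also have "norm x powr (- g) * (c * exp (r * ln (norm x))) = c * norm x powr (r - g)"
      using x by (simp add: powr_def exp_add[symmetric] algebra_simps)
    finally show "c * norm x powr (r - g) \<le> u (norm x)" .
  qed simp
  ultimately show ?thesis by (rule filterlim_at_top_mono)
qed

end
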